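(* Let $\mathcal{H}$ be a separable infinite-dimensional Hilbert space and let $\mathcal{F} = \{T_j\}_{j=n_0}^\infty \subseteq \mathcal{B}(\mathcal{H})$ be a forward operator monoid. Let $u, h \in \mathcal{H}$, with $u$ an aleph vector for $\mathcal{F}$. For each $N \ge n_0$ let $$P_N u = \sum_{j=n_0}^N c_j^{(N)} T_j h$$ be the orthogonal projection of $u$ onto $\operatorname{span}\{T_j h : j = n_0, \ldots, N\}$. Then $h$ is $\mathcal{F}$-inner if and only if $P_N u = P_{n_0} u$ for all $N \ge n_0$.
   Context: $\mathcal{B}(\mathcal{H})$ is the set of bounded linear operators on the complex Hilbert space $\mathcal{H}$, and $I$ is the identity operator. A collection $\mathcal{F} \subseteq \mathcal{B}(\mathcal{H})$ containing $I$ is a forward operator monoid if there is a commutative, discrete (countable), strict monoid $(\Lambda, b, n_0)$ (with binary operation $b$ and identity element $n_0$; strict means that it does not possess inverses) such that $\mathcal{F} = \{T_j\}_{j \in \Lambda}$ and the map $j \mapsto T_j$ is a monoid isomorphism from $(\Lambda, b, n_0)$ onto $(\mathcal{F}, \circ, I)$, where $\circ$ is composition. In particular: $T_{n_0} = I$; $T_jT_k = T_{b(j,k)}$ for all $j,k\in\Lambda$; the elements of $\mathcal{F}$ commute; and the forward properties hold: $T_jT_k = I$ if and only if $j=k=n_0$, and $T_jT_k = T_k$ if and only if $j = n_0$. By convention the index set is relabelled as $\Lambda = \{n_0, n_0+1, n_0+2, \ldots\}$, with $n_0$ still the identity element of the indexing monoid and $T_{n_0}=I$ (the operation $b$ need not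 be addition). A non-zero vector $h \in \mathcal{H}$ is $\mathcal{F}$-cyclic if the closed linear span $[h]_{\mathcal{F}}$ of $\{Th : T \in \mathcal{F}\}$ equals $\mathcal{H}$; it is $\mathcal{F}$-inner if $\langle Th, h\rangle = 0$ for all $T \in \mathcal{F}\setminus\{I\}$; it is an $\mathcal{F}$-aleph (aleph vector for $\mathcal{F}$) if it is both $\mathcal{F}$-cyclic and $\mathcal{F}$-inner.
   Formalization: The direction "P_N u = P_{n_0} u for all N implies h inner" is proved only when ⟨u,h⟩ ≠ 0; without this it fails (shift on H², u = 1, h = z + z²: all P_N u = 0 but h is not inner). The forward direction is unconditional. *)

theory Defs
  imports "HOL-Analysis.Analysis" "HOL-Algebra.Group"
begin

text \<open>
  The library only has real inner product spaces. A complex inner product space is set up here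
  on top of one whose real structure is the underlying real structure: real scalars act through
  the complex ones, and the real inner product is the real part of the complex one. In particular
  the norm, the topology and completeness are the library's. The inner product is linear in its
  first argument and conjugate linear in its second.
\<close>

class complex_inner = real_inner +
  fixes scaleC :: "complex \<Rightarrow> 'a \<Rightarrow> 'a" (infixr "*\<^sub>C" 75)
    and cinner :: "'a \<Rightarrow> 'a \<Rightarrow> complex"
  assumes scaleC_add_right: "a *\<^sub>C (x + y) = a *\<^sub>C x + a *\<^sub>C y"
    and scaleC_add_left: "(a + b) *\<^sub>C x = a *\<^sub>C x + b *\<^sub>C x"
    and scaleC_scaleC: "a *\<^sub>C (b *\<^sub>C x) = (a * b) *\<^sub>C x"
    and scaleC_one: "1 *\<^sub>C x = x"
    and scaleC_of_real: "complex_of_real r *\<^sub>C x = r *\<^sub>R x"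
    and cinner_commute: "cinner x y = cnj (cinner y x)"
    and cinner_add_left: "cinner (x + y) z = cinner x z + cinner y z"
    and cinner_scaleC_left: "cinner (a *\<^sub>C x) y = a * cinner x y"
    and Re_cinner: "Re (cinner x y) = inner x y"

class complex_hilbert = complex_inner + complete_space

instantiation complex :: complex_hilbert
begin

definition scaleC_complex :: "complex \<Rightarrow> complex \<Rightarrow> complex"
  where "scaleC_complex a x = a * x"

definition cinner_complex :: "complex \<Rightarrow> complex \<Rightarrow> complex"
  where "cinner_complex x y = x * cnj y"

instance
  by standard
    (auto simp: scaleC_complex_def cinner_complex_def inner_complex_def scaleR_conv_of_real
      algebra_simps)

end

global_interpretation complex_vector: vector_space "scaleC :: complex \<Rightarrow> 'a \<Rightarrow> 'a :: complex_inner"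
  defines cspan = complex_vector.span
  by unfold_locales (simp_all add: scaleC_add_right scaleC_add_left scaleC_scaleC scaleC_one)

definition infinite_dimensional :: "'a :: complex_inner itself \<Rightarrow> bool"
  where "infinite_dimensional _ \<longleftrightarrow> \<not> (\<exists>B :: 'a set. finite B \<and> cspan B = UNIV)"

definition bounded_clinear :: "('a :: complex_inner \<Rightarrow> 'a) \<Rightarrow> bool"
  where "bounded_clinear A \<longleftrightarrow> bounded_linear A \<and> (\<forall>c x. A (c *\<^sub>C x) = c *\<^sub>C A x)"

definition orth_proj :: "'a :: complex_inner set \<Rightarrow> 'a \<Rightarrow> 'a"
  where "orth_proj M x = (THE p. p \<in> M \<and> (\<forall>m\<in>M. cinner (x - p) m = 0))"

definition composition_monoid :: "('a \<Rightarrow> 'a) set \<Rightarrow> ('a \<Rightarrow> 'a) monoid"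
  where "composition_monoid F = \<lparr>carrier = F, mult = (\<circ>), one = id\<rparr>"

text \<open>
  Strictness, the absence of inverses, says that the identity is the only unit. It yields the
  first of the two forward properties, but not the second one (an absorbing element violates it),
  which is therefore listed explicitly.
\<close>

definition forward_operator_monoid ::
    "('i, 'm) monoid_scheme \<Rightarrow> ('i \<Rightarrow> 'a \<Rightarrow> 'a) \<Rightarrow> ('a :: complex_inner \<Rightarrow> 'a) set \<Rightarrow> bool"
  where "forward_operator_monoid L T F \<longleftrightarrow>
    comm_monoid L \<and> countable (carrier L) \<and> Units L = {\<one>\<^bsub>L\<^esub>} \<and>
    F \<subseteq> {A. bounded_clinear A} \<and> id \<in> F \<and>
    T \<in> iso L (composition_monoid F) \<and> T \<one>\<^bsub>L\<^esub> = id \<and>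
    (\<forall>j\<in>carrier L. \<forall>k\<in>carrier L. T j \<circ> T k = id \<longleftrightarrow> j = \<one>\<^bsub>L\<^esub> \<and> k = \<one>\<^bsub>L\<^esub>) \<and>
    (\<forall>j\<in>carrier L. \<forall>k\<in>carrier L. T j \<circ> T k = T k \<longleftrightarrow> j = \<one>\<^bsub>L\<^esub>)"

definition F_cyclic :: "('a :: complex_inner \<Rightarrow> 'a) set \<Rightarrow> 'a \<Rightarrow> bool"
  where "F_cyclic F h \<longleftrightarrow> h \<noteq> 0 \<and> closure (cspan ((\<lambda>A. A h) ` F)) = UNIV"

definition F_inner :: "('a :: complex_inner \<Rightarrow> 'a) set \<Rightarrow> 'a \<Rightarrow> bool"
  where "F_inner F h \<longleftrightarrow> h \<noteq> 0 \<and> (\<forall>A\<in>F - {id}. cinner (A h) h = 0)"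

definition F_aleph :: "('a :: complex_inner \<Rightarrow> 'a) set \<Rightarrow> 'a \<Rightarrow> bool"
  where "F_aleph F h \<longleftrightarrow> F_cyclic F h \<and> F_inner F h"

end

theory Submission
  imports Defs
begin

text \<open>
  The forward property lets the orthogonality relations of the aleph vector \<open>u\<close> spread to the
  whole space: if \<open>A \<noteq> id\<close> belongs to \<open>F\<close>, then so does \<open>A \<circ> B\<close> for every \<open>B\<close> in
  \<open>F\<close>, and \<open>A \<circ> B \<noteq> id\<close>; hence \<open>A\<close> maps every \<open>B u\<close> into the orthogonal complement of \<open>u\<close>
  because \<open>u\<close> is inner, and by linearity, continuity and cyclicity \<open>A\<close> maps the whole space
  there (\<open>aleph_orthogonal_range\<close>). So \<open>u\<close> is orthogonal to all \<open>T j h\<close> with \<open>j \<noteq> n0\<close>, whatever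
  \<open>h\<close> is.

  For \<open>h \<noteq> 0\<close> the projection of \<open>u\<close> onto the line through \<open>h\<close> is \<open>p = \<lambda> h\<close> with
  \<open>\<lambda> = \<langle>u, h\<rangle> / \<langle>h, h\<rangle>\<close>. It remains the projection onto the span of \<open>T n0 h, \<dots>, T N h\<close> exactly
  when \<open>u - \<lambda> h\<close> is orthogonal to \<open>T j h\<close> for \<open>n0 < j \<le> N\<close>, that is, in view of the above,
  when \<open>\<lambda> \<langle>h, T j h\<rangle> = 0\<close> for these \<open>j\<close>. If \<open>h\<close> is inner this holds; if \<open>\<lambda> \<noteq> 0\<close>, that is
  \<open>\<langle>u, h\<rangle> \<noteq> 0\<close>, it conversely forces \<open>h\<close> to be inner.
\<close>

lemma cinner_zero_left [simp]: "cinner 0 (y :: 'a :: complex_inner) = 0"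
  using cinner_add_left[of 0 0 y] by simp

lemma cinner_diff_left: "cinner (x - y) (z :: 'a :: complex_inner) = cinner x z - cinner y z"
  using cinner_add_left[of "x - y" y z] by simp

lemma cinner_eq_zero_commute: "cinner x (y :: 'a :: complex_inner) = 0 \<longleftrightarrow> cinner y x = 0"
  by (metis cinner_commute complex_cnj_zero)

lemma cinner_self_eq_zero [simp]: "cinner x x = 0 \<longleftrightarrow> (x :: 'a :: complex_inner) = 0"
  by (metis Re_cinner cinner_zero_left inner_eq_zero_iff zero_complex.sel(1))

lemma cinner_zero_right [simp]: "cinner (x :: 'a :: complex_inner) 0 = 0"
  by (simp add: cinner_eq_zero_commute[of x 0])

lemma complex_subspace_left_orthogonal:
  "complex_vector.subspace {x. cinner x (y :: 'a :: complex_inner) = 0}"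
  by (auto simp: complex_vector.subspace_def cinner_add_left cinner_scaleC_left)

lemma orthogonal_cspan:
  assumes "\<And>s. s \<in> S \<Longrightarrow> cinner x s = 0" and "m \<in> cspan S"
  shows "cinner x (m :: 'a :: complex_inner) = 0"
proof -
  have "cspan S \<subseteq> {m. cinner m x = 0}"
    by (rule complex_vector.span_minimal)
       (use assms(1) cinner_eq_zero_commute complex_subspace_left_orthogonal in blast)+
  then show ?thesis
    using assms(2) cinner_eq_zero_commute by blast
qed

text \<open>
  Both the real and the imaginary part of \<open>cinner x y\<close> are real inner products of \<open>x\<close> with a
  fixed vector, hence continuous in \<open>x\<close>.
\<close>

lemma closed_left_orthogonal: "closed {x. cinner x (y :: 'a :: complex_inner) = 0}"
proof -
  have "Im (cinner x y) = inner x (\<i> *\<^sub>C y)" for x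
  proof -
    have "inner x (\<i> *\<^sub>C y) = Re (cinner (\<i> *\<^sub>C y) x)"
      by (simp add: Re_cinner inner_commute)
    also have "\<dots> = - Im (cinner y x)"
      by (simp add: cinner_scaleC_left)
    also have "\<dots> = Im (cinner x y)"
      by (subst (2) cinner_commute) simp
    finally show ?thesis by simp
  qed
  then have "{x. cinner x y = 0} = {x. inner x y = 0} \<inter> {x. inner x (\<i> *\<^sub>C y) = 0}"
    by (auto simp: complex_eq_iff Re_cinner)
  moreover have "closed \<dots>"
    by (intro closed_Int closed_Collect_eq continuous_intros)
  ultimately show ?thesis by simp
qed

text \<open>
  One Gram-Schmidt step: adding a generator \<open>a\<close> to \<open>S\<close> extends the span by the part \<open>e\<close> of \<open>a\<close>
  orthogonal to \<open>S\<close>, and the projection changes by the component along \<open>e\<close>.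
\<close>

lemma finite_span_projection_exists:
  assumes "finite S"
  shows "\<exists>p\<in>cspan S. \<forall>s\<in>S. cinner (x - p) (s :: 'a :: complex_inner) = 0"
  using assms
proof (induction S arbitrary: x rule: finite_induct)
  case empty
  then show ?case
    using complex_vector.span_zero by blast
next
  case (insert a S)
  obtain p where p: "p \<in> cspan S" "\<And>s. s \<in> S \<Longrightarrow> cinner (x - p) s = 0"
    using insert.IH by blast
  obtain q where q: "q \<in> cspan S" "\<And>s. s \<in> S \<Longrightarrow> cinner (a - q) s = 0"
    using insert.IH by blast
  define e where "e = a - q"
  \<comment> \<open>If \<open>e = 0\<close> the coefficient is \<open>0\<close> by the convention for division, and the formula still holds.\<close>
  define p' where "p' = p + (cinner (x - p) e / cinner e e) *\<^sub>C e"
  have mono: "cspan S \<subseteq> cspan (insert a S)"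
    by (rule complex_vector.span_mono) auto
  have "e \<in> cspan (insert a S)"
    unfolding e_def using q(1) mono
    by (blast intro: complex_vector.span_diff complex_vector.span_base)
  then have mem: "p' \<in> cspan (insert a S)"
    unfolding p'_def using p(1) mono
    by (blast intro: complex_vector.span_add complex_vector.span_scale)
  have x_p': "x - p' = (x - p) - (cinner (x - p) e / cinner e e) *\<^sub>C e"
    by (simp add: p'_def)
  have on_S: "cinner (x - p') s = 0" if "s \<in> S" for s
    unfolding x_p' using p(2) q(2) that
    by (simp add: e_def cinner_diff_left[of "x - p"] cinner_scaleC_left)
  have "cinner (x - p') q = 0"
    using on_S q(1) by (rule orthogonal_cspan)
  moreover have "cinner (x - p') e = 0"
    by (cases "e = 0")
       (simp_all add: x_p' cinner_diff_left[of "x - p"] cinner_scaleC_left)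
  ultimately have "cinner (e + q) (x - p') = 0"
    using cinner_eq_zero_commute[of "x - p'"] by (simp add: cinner_add_left)
  then have "cinner (x - p') a = 0"
    using cinner_eq_zero_commute[of "x - p'" a] by (simp add: e_def)
  then show ?case
    using mem on_S by blast
qed

lemma orth_proj_cspan_eqI:
  assumes "p \<in> cspan S" and "\<And>s. s \<in> S \<Longrightarrow> cinner (x - p) s = 0"
  shows "orth_proj (cspan S) x = (p :: 'a :: complex_inner)"
  unfolding orth_proj_def
proof (rule the_equality)
  show orth: "p \<in> cspan S \<and> (\<forall>m\<in>cspan S. cinner (x - p) m = 0)"
    using assms orthogonal_cspan by blast
  fix q assume q: "q \<in> cspan S \<and> (\<forall>m\<in>cspan S. cinner (x - q) m = 0)"
  have "q - p \<in> cspan S"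
    using q assms(1) by (blast intro: complex_vector.span_diff)
  moreover have "q - p = (x - p) - (x - q)"
    by simp
  ultimately have "cinner (q - p) (q - p) = 0"
    using q orth by (metis cinner_diff_left diff_zero)
  then show "q = p"
    by simp
qed

text \<open>
  Because \<open>orth_proj\<close> is a definite description, its value is known to be orthogonal to the span
  only once a projection has been shown to exist.
\<close>

lemma orth_proj_finite_span_orthogonal:
  assumes "finite S" and "s \<in> S"
  shows "cinner (x - orth_proj (cspan S) x) (s :: 'a :: complex_inner) = 0"
proof -
  obtain p where "p \<in> cspan S" "\<forall>s\<in>S. cinner (x - p) s = 0"
    using finite_span_projection_exists[OF assms(1)] by blast
  then show ?thesis
    using assms(2) by (simp add: orth_proj_cspan_eqI)
qed

lemma forward_operator_monoid_image:
  assumes "forward_operator_monoid L T F"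
  shows "T ` carrier L = F"
proof -
  have "T \<in> iso L (composition_monoid F)"
    using assms by (simp add: forward_operator_monoid_def)
  then show ?thesis
    by (simp add: composition_monoid_def iso_def bij_betw_def)
qed

lemma forward_operator_monoid_eq_id_iff:
  assumes "forward_operator_monoid L T F" and "j \<in> carrier L"
  shows "T j = id \<longleftrightarrow> j = \<one>\<^bsub>L\<^esub>"
proof -
  have "\<one>\<^bsub>L\<^esub> \<in> carrier L"
    using assms(1)
    by (intro monoid.one_closed comm_monoid.axioms(1)) (simp add: forward_operator_monoid_def)
  then have "T j \<circ> T \<one>\<^bsub>L\<^esub> = id \<longleftrightarrow> j = \<one>\<^bsub>L\<^esub>"
    using assms unfolding forward_operator_monoid_def by blast
  moreover have "T \<one>\<^bsub>L\<^esub> = id"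
    using assms(1) by (simp add: forward_operator_monoid_def)
  ultimately show ?thesis
    by simp
qed

lemma forward_operator_monoid_comp:
  assumes "forward_operator_monoid L T F" and "A \<in> F - {id}" and "B \<in> F"
  shows "A \<circ> B \<in> F - {id}"
proof -
  obtain j k where jk: "j \<in> carrier L" "A = T j" "k \<in> carrier L" "B = T k"
    using assms forward_operator_monoid_image[OF assms(1)] by blast
  have "j \<otimes>\<^bsub>L\<^esub> k \<in> carrier L"
    using assms(1) jk(1,3)
    by (intro monoid.m_closed comm_monoid.axioms(1)) (simp_all add: forward_operator_monoid_def)
  moreover have "T (j \<otimes>\<^bsub>L\<^esub> k) = A \<circ> B"
  proof -
    have "T \<in> hom L (composition_monoid F)"
      using assms(1) by (simp add: forward_operator_monoid_def iso_def)
    then show ?thesis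
      using jk by (simp add: hom_def composition_monoid_def)
  qed
  ultimately have "A \<circ> B \<in> F"
    using forward_operator_monoid_image[OF assms(1)] by (metis imageI)
  moreover have "A \<circ> B \<noteq> id"
  proof -
    have "j \<noteq> \<one>\<^bsub>L\<^esub>"
      using forward_operator_monoid_eq_id_iff[OF assms(1) jk(1)] assms(2) jk(2) by simp
    moreover have "T j \<circ> T k = id \<longleftrightarrow> j = \<one>\<^bsub>L\<^esub> \<and> k = \<one>\<^bsub>L\<^esub>"
      using assms(1) jk(1,3) by (simp add: forward_operator_monoid_def)
    ultimately show ?thesis
      using jk(2,4) by simp
  qed
  ultimately show ?thesis
    by blast
qed

text \<open>
  The set of all \<open>x\<close> with \<open>A x\<close> orthogonal to \<open>u\<close> is a closed subspace, so by cyclicity it is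
  enough that it contains each \<open>B u\<close>; and \<open>A (B u)\<close> is orthogonal to \<open>u\<close> because \<open>A \<circ> B\<close> is again
  an element of \<open>F\<close> other than the identity.
\<close>

lemma aleph_orthogonal_range:
  assumes fom: "forward_operator_monoid L T F" and "F_aleph F u" and A: "A \<in> F - {id}"
  shows "cinner (A x) u = 0"
proof -
  let ?W = "{x. cinner (A x) u = 0}"
  have "bounded_clinear A"
    using fom A by (auto simp: forward_operator_monoid_def)
  then have lin: "bounded_linear A" "\<And>a y. A (a *\<^sub>C y) = a *\<^sub>C A y"
    by (auto simp: bounded_clinear_def)
  have "complex_vector.subspace ?W"
    using lin by (auto simp: complex_vector.subspace_def linear_simps cinner_add_left
        cinner_scaleC_left)
  moreover have "(\<lambda>B. B u) ` F \<subseteq> ?W"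
  proof clarify
    fix B assume "B \<in> F"
    then have "cinner ((A \<circ> B) u) u = 0"
      using forward_operator_monoid_comp[OF fom A] \<open>F_aleph F u\<close>
      unfolding F_aleph_def F_inner_def by blast
    then show "cinner (A (B u)) u = 0"
      by simp
  qed
  ultimately have "cspan ((\<lambda>B. B u) ` F) \<subseteq> ?W"
    by (intro complex_vector.span_minimal)
  moreover have "closed ?W"
    using closed_vimage[OF closed_left_orthogonal, of A u] lin(1)
    by (simp add: vimage_def linear_continuous_on continuous_on_eq_continuous_at
        linear_continuous_at)
  ultimately have "closure (cspan ((\<lambda>B. B u) ` F)) \<subseteq> ?W"
    by (rule closure_minimal)
  then show ?thesis
    using \<open>F_aleph F u\<close> by (auto simp: F_aleph_def F_cyclic_def)
qed

theorem theorem4p7: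
  fixes b :: "int \<Rightarrow> int \<Rightarrow> int" and n0 :: int
    and T :: "int \<Rightarrow> 'a :: complex_hilbert \<Rightarrow> 'a" and F :: "('a \<Rightarrow> 'a) set"
    and u h :: 'a and P :: "int \<Rightarrow> 'a" and c :: "int \<Rightarrow> int \<Rightarrow> complex"
  assumes "separable_space (euclidean :: 'a topology)"
    and "infinite_dimensional TYPE('a)"
    and "forward_operator_monoid \<lparr>carrier = {n0..}, mult = b, one = n0\<rparr> T F"
    and "F_aleph F u"
    and "\<And>N. N \<ge> n0 \<Longrightarrow> P N = orth_proj (cspan ((\<lambda>j. T j h) ` {n0..N})) u"
    and "\<And>N. N \<ge> n0 \<Longrightarrow> P N = (\<Sum>j=n0..N. c N j *\<^sub>C T j h)"
  shows "(F_inner F h \<longrightarrow> (\<forall>N\<ge>n0. P N = P n0)) \<and>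
    (cinner u h \<noteq> 0 \<longrightarrow> (F_inner F h \<longleftrightarrow> (\<forall>N\<ge>n0. P N = P n0)))"
proof -
  note fom = assms(3) and proj = assms(5)
  have F: "F = T ` {n0..}"
    using forward_operator_monoid_image[OF fom] by simp
  have T_id: "T j = id \<longleftrightarrow> j = n0" if "j \<ge> n0" for j
    using forward_operator_monoid_eq_id_iff[OF fom, of j] that by simp
  have u_orth: "cinner u (T j h) = 0" if "j > n0" for j
    using aleph_orthogonal_range[OF fom assms(4), of "T j" h] F T_id[of j] that
      cinner_eq_zero_commute by force
  define p where "p = (cinner u h / cinner h h) *\<^sub>C h"
  have p_orth_h: "cinner (u - p) h = 0"
    by (cases "h = 0")
       (simp_all add: p_def cinner_diff_left cinner_scaleC_left)
  have P_eq: "P N = p"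
    if "N \<ge> n0" and orth: "\<And>j. n0 < j \<Longrightarrow> j \<le> N \<Longrightarrow> cinner (u - p) (T j h) = 0" for N
    unfolding proj[OF that(1)]
  proof (rule orth_proj_cspan_eqI)
    have "h \<in> (\<lambda>j. T j h) ` {n0..N}"
      using that(1) T_id[of n0] by (force intro: image_eqI[of _ _ n0])
    then show "p \<in> cspan ((\<lambda>j. T j h) ` {n0..N})"
      unfolding p_def by (intro complex_vector.span_scale complex_vector.span_base)
    show "cinner (u - p) s = 0" if s: "s \<in> (\<lambda>j. T j h) ` {n0..N}" for s
    proof -
      obtain j where j: "n0 \<le> j" "j \<le> N" "s = T j h"
        using s by auto
      show ?thesis
        using p_orth_h orth[of j] j T_id[of n0] by (cases "j = n0") auto
    qed
  qed
  have P_n0: "P n0 = p"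
    by (rule P_eq) auto
  have inner_imp: "\<forall>N\<ge>n0. P N = P n0" if "F_inner F h"
  proof (intro allI impI)
    fix N :: int assume "N \<ge> n0"
    then have "P N = p"
    proof (rule P_eq)
      fix j assume "n0 < j" "j \<le> N"
      then have "cinner (T j h) h = 0"
        using that F T_id[of j] by (force simp: F_inner_def)
      then show "cinner (u - p) (T j h) = 0"
        using u_orth[OF \<open>n0 < j\<close>] cinner_eq_zero_commute[of "T j h" h]
        by (simp add: p_def cinner_diff_left cinner_scaleC_left)
    qed
    then show "P N = P n0"
      by (simp add: P_n0)
  qed
  have imp_inner: "F_inner F h" if uh: "cinner u h \<noteq> 0" and const: "\<forall>N\<ge>n0. P N = P n0"
    unfolding F_inner_def
  proof (intro conjI ballI)
    show "h \<noteq> 0"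
      using uh by auto
    fix A assume "A \<in> F - {id}"
    then obtain j where j: "A = T j" "j > n0"
      using F T_id by fastforce
    have "cinner (u - P j) (T j h) = 0"
      unfolding proj[OF less_imp_le[OF j(2)]] using j(2)
      by (intro orth_proj_finite_span_orthogonal) auto
    then have "cinner p (T j h) = 0"
      using const j(2) P_n0 u_orth[OF j(2)] by (simp add: cinner_diff_left)
    then have "cinner h (T j h) = 0"
      using uh \<open>h \<noteq> 0\<close> by (simp add: p_def cinner_scaleC_left)
    then show "cinner (A h) h = 0"
      using j(1) cinner_eq_zero_commute by blast
  qed
  show ?thesis
    using inner_imp imp_inner by blast
qed

end
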